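(* Let $P_{(1,1,0)}$ be the set of all cylindric partitions with profile $c=(1,1,0)$. Then, as formal power series in $q$, $$\sum_{\Lambda\in P_{(1,1,0)}} q^{|\Lambda|}=\left(\sum_{n\ge0}\frac{q^{n^2}}{(q^4;q^4)_n}\right)\frac{(-q^2;q^2)_\infty}{(q;q)_\infty}.$$
   Context: Let $r,\ell$ be positive integers and $c=(c_1,\dots,c_r)$ a composition of $\ell$ into $r$ nonnegative integer parts (zero entries allowed). A cylindric partition with profile $c$ is a tuple $\Lambda=(\lambda^{(1)},\dots,\lambda^{(r)})$ of ordinary partitions $\lambda^{(i)}=(\lambda^{(i)}_1\ge\lambda^{(i)}_2\ge\cdots)$ (parts beyond the length are taken to be $0$) such that for all $i,j$: $\lambda^{(i)}_j\ge\lambda^{(i+1)}_{j+c_{i+1}}$ for $1\le i\le r-1$, and $\lambda^{(r)}_j\ge\lambda^{(1)}_{j+c_1}$. The size $|\Lambda|$ is the sum of all parts of all $\lambda^{(i)}$; the empty cylindric partition is included with size $0$. Notation: $(a;q)_n=\prod_{k=1}^n(1-aq^{k-1})$, $(a;q)_\infty=\lim_{n\to\infty}(a;q)_n$. *)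

theory Defs
  imports "HOL-Analysis.Infinite_Sum" "HOL-Computational_Algebra.Formal_Power_Series"
begin

text \<open>
  A partition is identified with the sequence of its parts, padded with zeros. Parts, and the
  entries of a tuple, are indexed from \<open>0\<close>: \<open>l j\<close> is the part that is written with
  subscript \<open>j + 1\<close> on paper. The inequalities below compare parts only up to a shift, so
  their form is not affected by this.
\<close>

definition is_partition :: "(nat \<Rightarrow> nat) \<Rightarrow> bool" where
  "is_partition l \<longleftrightarrow> antimono l \<and> finite {j. l j \<noteq> 0}"

definition partition_size :: "(nat \<Rightarrow> nat) \<Rightarrow> nat" where
  "partition_size l = (\<Sum>j | l j \<noteq> 0. l j)"

text \<open>
  The profile is the list \<open>c\<close> of its entries and the rank is \<open>length c\<close>; the definition is
  meaningful only for \<open>c \<noteq> []\<close>. Zero entries are allowed in \<open>c\<close> and empty partitions in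
  \<open>L\<close>.
\<close>

definition cylindric_partitions :: "nat list \<Rightarrow> (nat \<Rightarrow> nat) list set" where
  "cylindric_partitions c =
     {L. length L = length c \<and>
         (\<forall>l\<in>set L. is_partition l) \<and>
         (\<forall>i j. i + 1 < length c \<longrightarrow> (L ! i) j \<ge> (L ! (i + 1)) (j + c ! (i + 1))) \<and>
         (\<forall>j. (L ! (length c - 1)) j \<ge> (L ! 0) (j + c ! 0))}"

definition cylindric_size :: "(nat \<Rightarrow> nat) list \<Rightarrow> nat" where
  "cylindric_size L = (\<Sum>l\<leftarrow>L. partition_size l)"

definition qpoch :: "'a::comm_ring_1 \<Rightarrow> 'a \<Rightarrow> nat \<Rightarrow> 'a" where
  "qpoch a q n = (\<Prod>k=1..n. 1 - a * q ^ (k - 1))"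

text \<open>
  For formal power series the limit is the one of the metric \<^term>\<open>dist :: rat fps \<Rightarrow> rat fps \<Rightarrow> real\<close>
  of the library, i.e. every coefficient is eventually constant.
\<close>

definition qpoch_inf :: "'a::{comm_ring_1, t2_space} \<Rightarrow> 'a \<Rightarrow> 'a" where
  "qpoch_inf a q = lim (qpoch a q)"

end

theory Submission
  imports Defs
begin

text \<open>
  Interleave the three rows of a cylindric partition of profile \<open>(1,1,0)\<close>, taking the parts
  \<open>\<lambda>\<^bsup>(2)\<^esup>\<^sub>j, \<lambda>\<^bsup>(1)\<^esup>\<^sub>j, \<lambda>\<^bsup>(3)\<^esup>\<^sub>j\<close> for \<open>j = 1, 2, \<dots>\<close> in turn: all
  defining inequalities together say that the resulting sequence satisfies
  \<open>f k \<ge> f (k + 2)\<close> and \<open>f k \<ge> f (k + 3)\<close>. The positions with \<open>f k < f (k + 1)\<close> are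
  never adjacent, and swapping the two entries at each of them sorts \<open>f\<close> into a partition that
  drops strictly there. Removing \<open>1\<close> from the first \<open>k + 1\<close> entries for each such \<open>k\<close>
  leaves an arbitrary partition, so the generating function is \<open>1 / (q; q)\<^sub>\<infinity>\<close> times that of the
  finite sets of positive integers without two consecutive elements.

  Let \<open>E\<^sub>j\<close> count the sets of this kind with all elements above \<open>j\<close>. Then
  \<open>E\<^sub>j = E\<^bsub>j+1\<^esub> + q\<^bsup>j+1\<^esup> E\<^bsub>j+2\<^esub>\<close>, and eliminating odd indices gives a second-order
  recurrence for \<open>E\<^bsub>2i\<^esub>\<close>. A telescoping argument shows that
  \<open>\<Sum>n. z\<^sup>n q\<^bsup>n\<^sup>2\<^esup> (-z q\<^bsup>2n+2\<^esup>; q\<^sup>2)\<^sub>\<infinity> / (q\<^sup>2; q\<^sup>2)\<^sub>n\<close> at \<open>z = q\<^bsup>2i\<^esup>\<close> obeys the same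
  recurrence. Both sequences tend to \<open>1\<close>, so they agree; the case \<open>i = 0\<close> is the claim.
\<close>

subsection \<open>Convergence of formal power series\<close>

text \<open>Coefficient \<open>n\<close> of a product involves only the coefficients
  \<open>0..n\<close> of the factors, so finitely many eventual equalities suffice.\<close>

lemma tendsto_mult_fps:
  fixes f g :: "'b \<Rightarrow> 'a::ring_1 fps"
  assumes "(f \<longlongrightarrow> a) F" and "(g \<longlongrightarrow> b) F"
  shows "((\<lambda>x. f x * g x) \<longlongrightarrow> a * b) F"
proof (rule tendsto_fpsI)
  fix n
  have "eventually (\<lambda>x. \<forall>i\<in>{0..n}. fps_nth (f x) i = fps_nth a i) F"
    by (subst eventually_ball_finite_distrib) (use assms(1) in \<open>auto simp: tendsto_fps_iff\<close>)
  moreover have "eventually (\<lambda>x. \<forall>i\<in>{0..n}. fps_nth (g x) i = fps_nth b i) F"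
    by (subst eventually_ball_finite_distrib) (use assms(2) in \<open>auto simp: tendsto_fps_iff\<close>)
  ultimately show "eventually (\<lambda>x. fps_nth (f x * g x) n = fps_nth (a * b) n) F"
    by eventually_elim (auto simp: fps_mult_nth intro!: sum.cong)
qed

lemma tendsto_diff_fps:
  fixes f g :: "'b \<Rightarrow> 'a::ring_1 fps"
  assumes "(f \<longlongrightarrow> a) F" and "(g \<longlongrightarrow> b) F"
  shows "((\<lambda>x. f x - g x) \<longlongrightarrow> a - b) F"
proof (rule tendsto_fpsI)
  fix n
  from assms have "eventually (\<lambda>x. fps_nth (f x) n = fps_nth a n) F"
    and "eventually (\<lambda>x. fps_nth (g x) n = fps_nth b n) F"
    by (auto simp: tendsto_fps_iff)
  then show "eventually (\<lambda>x. fps_nth (f x - g x) n = fps_nth (a - b) n) F"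
    by eventually_elim auto
qed

text \<open>Coefficient \<open>k\<close> is frozen from index \<open>k\<close> on, so the diagonal
  reads off the limit.\<close>

lemma convergent_fps:
  fixes S :: "nat \<Rightarrow> 'a::ring_1 fps"
  assumes "\<And>n k. k \<le> n \<Longrightarrow> fps_nth (S (Suc n)) k = fps_nth (S n) k"
  shows "S \<longlonglongrightarrow> Abs_fps (\<lambda>n. fps_nth (S n) n)"
proof (rule tendsto_fpsI)
  fix k
  have "fps_nth (S n) k = fps_nth (S k) k" if "n \<ge> k" for n
    using that by (induction n rule: dec_induct) (auto simp: assms)
  then show "\<forall>\<^sub>F n in sequentially. fps_nth (S n) k = fps_nth (Abs_fps (\<lambda>n. fps_nth (S n) n)) k"
    unfolding eventually_sequentially fps_nth_Abs_fps by blast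
qed

lemma summable_fps:
  fixes f :: "nat \<Rightarrow> 'a::ring_1 fps"
  assumes "\<And>n k. k \<le> n \<Longrightarrow> fps_nth (f (Suc n)) k = 0"
  shows "summable f"
proof -
  have "(\<lambda>n. sum f {..n}) \<longlonglongrightarrow> Abs_fps (\<lambda>n. fps_nth (sum f {..n}) n)"
    by (rule convergent_fps) (simp add: assms fps_sum_nth)
  then show ?thesis
    unfolding summable_def sums_def_le by blast
qed

section \<open>Finite q-Pochhammer products\<close>

lemma qpoch_0 [simp]: "qpoch a q 0 = 1"
  by (simp add: qpoch_def)

lemma qpoch_Suc: "qpoch a q (Suc n) = qpoch a q n * (1 - a * q ^ n)"
  by (simp add: qpoch_def)

lemma qpoch_fps_nth_0:
  fixes a q :: "'a::comm_ring_1 fps"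
  assumes "fps_nth a 0 = 0"
  shows "fps_nth (qpoch a q n) 0 = 1"
  by (induction n) (simp_all add: qpoch_Suc assms)

text \<open>Each factor is a difference of squares. With \<open>fps_X\<^sup>2\<close> for both
  \<open>a\<close> and \<open>q\<close>, this turns the denominators of the claim into those of
  \<open>rr_term 0 n\<close>.\<close>

lemma qpoch_square: "qpoch (a ^ 2) (q ^ 2) n = qpoch a q n * qpoch (- a) q n"
proof (induction n)
  case (Suc n)
  have "1 - a ^ 2 * (q ^ 2) ^ n = (1 - a * q ^ n) * (1 - - a * q ^ n)"
    by (simp add: algebra_simps power2_eq_square power_mult_distrib)
  then show ?case
    by (simp add: qpoch_Suc Suc.IH mult_ac)
qed simp

subsection \<open>Generating functions\<close>

text \<open>Since \<open>card\<close> of an infinite set is \<open>0\<close>, this is the true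
  generating function only where all fibres of \<open>s\<close> are finite; hence the finiteness
  lemmas for each family below.\<close>

definition gen_fun :: "'b set \<Rightarrow> ('b \<Rightarrow> nat) \<Rightarrow> 'a::semiring_1 fps" where
  "gen_fun A s = Abs_fps (\<lambda>n. of_nat (card {a\<in>A. s a = n}))"

lemma gen_fun_nth: "fps_nth (gen_fun A s) n = of_nat (card {a\<in>A. s a = n})"
  by (simp add: gen_fun_def)

text \<open>Only the finite fibre over \<open>n\<close> contributes to coefficient \<open>n\<close>.
  This links the infinite sum of the theorem to counting.\<close>

lemma has_sum_gen_fun:
  assumes "\<And>n. finite {a\<in>A. s a = n}"
  shows "((\<lambda>a. fps_X ^ s a) has_sum (gen_fun A s :: 'a::ring_1 fps)) A"
proof (rule has_sum_fpsI)
  fix n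
  have eq: "{a\<in>A. fps_nth (fps_X ^ s a :: 'a fps) n \<noteq> 0} = {a\<in>A. s a = n}"
    by auto
  show "finite {a\<in>A. fps_nth (fps_X ^ s a :: 'a fps) n \<noteq> 0}"
    unfolding eq by (rule assms)
  show "fps_nth (gen_fun A s) n =
      (\<Sum>a | a \<in> A \<and> fps_nth (fps_X ^ s a :: 'a fps) n \<noteq> 0. fps_nth (fps_X ^ s a) n)"
    unfolding eq by (simp add: gen_fun_nth)
qed

lemma bij_betw_fibre:
  assumes "bij_betw \<phi> A B" and "\<And>a. a \<in> A \<Longrightarrow> t (\<phi> a) = s a"
  shows "bij_betw \<phi> {a\<in>A. s a = n} {b\<in>B. t b = n}"
  using assms unfolding bij_betw_def by (auto intro: inj_on_subset)

lemma gen_fun_bij_betw: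
  assumes "bij_betw \<phi> A B" and "\<And>a. a \<in> A \<Longrightarrow> t (\<phi> a) = s a"
  shows "gen_fun B t = gen_fun A s"
  using bij_betw_same_card[OF bij_betw_fibre[where \<phi> = \<phi> and s = s and t = t, OF assms]]
  by (simp add: gen_fun_def)

lemma gen_fun_Un:
  assumes "A \<inter> B = {}" and "\<And>n. finite {a\<in>A. s a = n}" and "\<And>n. finite {a\<in>B. s a = n}"
  shows "gen_fun (A \<union> B) s = gen_fun A s + gen_fun B s"
proof (rule fps_ext)
  fix n
  have "{a\<in>A \<union> B. s a = n} = {a\<in>A. s a = n} \<union> {a\<in>B. s a = n}"
    by auto
  moreover have "card \<dots> = card {a\<in>A. s a = n} + card {a\<in>B. s a = n}"
    using assms by (intro card_Un_disjoint) auto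
  ultimately show "fps_nth (gen_fun (A \<union> B) s) n = fps_nth (gen_fun A s + gen_fun B s) n"
    by (simp add: gen_fun_nth)
qed

lemma gen_fun_shift:
  "gen_fun A (\<lambda>a. s a + k) = fps_X ^ k * gen_fun A s"
proof (rule fps_ext)
  fix n
  have "{a\<in>A. s a + k = n} = (if n < k then {} else {a\<in>A. s a = n - k})"
    by auto
  then show "fps_nth (gen_fun A (\<lambda>a. s a + k)) n = fps_nth (fps_X ^ k * gen_fun A s) n"
    by (auto simp: gen_fun_nth fps_X_power_mult_nth)
qed

text \<open>The fibre over \<open>n\<close> is the disjoint union over \<open>i\<close> of products
  of the fibres over \<open>i\<close> and \<open>n - i\<close>, which matches the Cauchy
  product.\<close>

lemma
  assumes "\<And>n. finite {a\<in>A. s a = n}" and "\<And>n. finite {b\<in>B. t b = n}"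
  shows finite_fibre_Times: "finite {x\<in>A \<times> B. s (fst x) + t (snd x) = n}"
    and gen_fun_Times: "gen_fun (A \<times> B) (\<lambda>x. s (fst x) + t (snd x)) = gen_fun A s * gen_fun B t"
proof -
  have eq: "{x\<in>A \<times> B. s (fst x) + t (snd x) = n} =
      (\<Union>i\<in>{0..n}. {a\<in>A. s a = i} \<times> {b\<in>B. t b = n - i})" for n
    by auto
  show "finite {x\<in>A \<times> B. s (fst x) + t (snd x) = n}"
    unfolding eq using assms by auto
  show "gen_fun (A \<times> B) (\<lambda>x. s (fst x) + t (snd x)) = gen_fun A s * gen_fun B t"
  proof (rule fps_ext)
    fix n
    have "card {x\<in>A \<times> B. s (fst x) + t (snd x) = n} =
        (\<Sum>i=0..n. card ({a\<in>A. s a = i} \<times> {b\<in>B. t b = n - i}))"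
      unfolding eq using assms by (intro card_UN_disjoint) auto
    then show "fps_nth (gen_fun (A \<times> B) (\<lambda>x. s (fst x) + t (snd x))) n =
        fps_nth (gen_fun A s * gen_fun B t) n"
      by (simp add: gen_fun_nth fps_mult_nth card_cartesian_product)
  qed
qed

text \<open>\<open>z\<close> is the only element of \<open>A j\<close> of size at most
  \<open>j\<close>, so the coefficients up to \<open>j\<close> already agree with those of
  \<open>1\<close>.\<close>

lemma gen_fun_LIMSEQ_1:
  fixes A :: "nat \<Rightarrow> 'b set"
  assumes "\<And>j. z \<in> A j" and "s z = 0" and "\<And>j a. a \<in> A j \<Longrightarrow> a \<noteq> z \<Longrightarrow> s a > j"
  shows "(\<lambda>j. gen_fun (A j) s) \<longlonglongrightarrow> (1 :: 'a::ring_1 fps)"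
proof (rule tendsto_fpsI)
  fix n
  have "fps_nth (gen_fun (A j) s) n = fps_nth (1 :: 'a fps) n" if "j \<ge> n" for j
  proof -
    have "{a\<in>A j. s a = n} = (if n = 0 then {z} else {})"
      using assms that by (fastforce split: if_splits)
    then show ?thesis
      by (simp add: gen_fun_nth)
  qed
  then show "\<forall>\<^sub>F j in sequentially. fps_nth (gen_fun (A j) s) n = fps_nth (1 :: 'a fps) n"
    unfolding eventually_sequentially by blast
qed

subsection \<open>Partitions\<close>

lemma partition_size_eq_sum:
  assumes "finite A" and "{j. l j \<noteq> 0} \<subseteq> A"
  shows "partition_size l = sum l A"
  unfolding partition_size_def using assms by (intro sum.mono_neutral_left) auto

lemma is_partitionI:
  assumes "\<And>k. l (Suc k) \<le> l k" and "finite {j. l j \<noteq> 0}"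
  shows "is_partition l"
  using assms by (simp add: is_partition_def antimono_iff_le_Suc)

lemma is_partitionD:
  assumes "is_partition l"
  shows "i \<le> j \<Longrightarrow> l j \<le> l i" and "finite {j. l j \<noteq> 0}"
  using assms by (auto simp: is_partition_def antimonoD)

lemma is_partition_zero: "is_partition (\<lambda>_. 0)"
  by (simp add: is_partition_def monotone_def)

lemma partition_size_zero [simp]: "partition_size (\<lambda>_. 0) = 0"
  by (simp add: partition_size_def)

text \<open>Each of the first \<open>k + 1\<close> parts is at least \<open>h k\<close>. This bounds
  both the parts and their number.\<close>

lemma partition_size_ge:
  assumes "is_partition h" and "h k \<noteq> 0"
  shows "(k + 1) * h k \<le> partition_size h"
proof -
  have fin: "finite {j. h j \<noteq> 0}" and anti: "antimono h"
    using assms by (auto simp: is_partition_def)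
  have sub: "{..k} \<subseteq> {j. h j \<noteq> 0}"
    using assms(2) antimonoD[OF anti] by force
  have "(k + 1) * h k = (\<Sum>j\<le>k. h k)"
    by simp
  also have "\<dots> \<le> sum h {..k}"
    using antimonoD[OF anti] by (intro sum_mono) auto
  also have "\<dots> \<le> partition_size h"
    unfolding partition_size_def by (rule sum_mono2[OF fin sub]) auto
  finally show ?thesis .
qed

lemma finite_partitions_of_size: "finite {h\<in>Collect is_partition. partition_size h = n}"
proof (rule finite_subset)
  show "{h\<in>Collect is_partition. partition_size h = n} \<subseteq>
      {h. \<forall>k. (k \<in> {..<n} \<longrightarrow> h k \<in> {..n}) \<and> (k \<notin> {..<n} \<longrightarrow> h k = 0)}"
  proof clarsimp
    fix h k
    assume h: "is_partition h"
    have 1: "(k + 1) * h k \<le> partition_size h" if "h k \<noteq> 0"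
      using partition_size_ge[OF h that] .
    have "h k \<le> partition_size h"
      using 1 by (cases "h k = 0") auto
    moreover have "h k = 0" if "\<not> k < partition_size h"
    proof (rule ccontr)
      assume "h k \<noteq> 0"
      then have "k + 1 \<le> (k + 1) * h k" by (cases "h k") simp_all
      with 1 that \<open>h k \<noteq> 0\<close> show False by linarith
    qed
    ultimately show "(k < partition_size h \<longrightarrow> h k \<le> partition_size h) \<and>
        (\<not> k < partition_size h \<longrightarrow> h k = 0)"
      by blast
  qed
  show "finite {h. \<forall>k. (k \<in> {..<n} \<longrightarrow> h k \<in> {..n}) \<and> (k \<notin> {..<n} \<longrightarrow> h k = 0)}"
    by (rule finite_set_of_finite_funs) auto
qed

text \<open>The conjugates are the partitions without parts in \<open>1..j\<close>, so the
  generating function is the product of \<open>1 / (1 - q^m)\<close> over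
  \<open>m > j\<close>.\<close>

definition flat_partitions :: "nat \<Rightarrow> (nat \<Rightarrow> nat) set" where
  "flat_partitions j = {h. is_partition h \<and> h j = h 0}"

lemma finite_flat_partitions_of_size: "finite {h\<in>flat_partitions j. partition_size h = n}"
  by (rule finite_subset[OF _ finite_partitions_of_size[of n]]) (auto simp: flat_partitions_def)

lemma flat_partitions_const:
  assumes "h \<in> flat_partitions j" and "k \<le> j"
  shows "h k = h 0"
proof -
  have "antimono h" "h j = h 0" using assms(1) by (auto simp: flat_partitions_def is_partition_def)
  then show ?thesis
    using antimonoD[of h k j] antimonoD[of h 0 k] assms(2) by simp
qed

text \<open>Either the initial run of equal parts extends to index \<open>j + 1\<close>, or the
  partition drops right after \<open>j\<close>. In the second case, subtracting \<open>1\<close>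
  from the first \<open>j + 1\<close> parts leaves an arbitrary element of
  \<open>flat_partitions j\<close>.\<close>

lemma gen_fun_flat_partitions_rec:
  "(gen_fun (flat_partitions j) partition_size :: 'a::ring_1 fps) =
     gen_fun (flat_partitions (Suc j)) partition_size +
     fps_X ^ Suc j * gen_fun (flat_partitions j) partition_size"
proof -
  define D where "D = {h\<in>flat_partitions j. h j \<noteq> h (Suc j)}"
  define \<phi> where "\<phi> = (\<lambda>h k. if k \<le> j then h k + 1 else h k :: nat)"
  define \<psi> where "\<psi> = (\<lambda>h k. if k \<le> j then h k - 1 else h k :: nat)"
  have D_gt: "h j > h (Suc j)" if "h \<in> D" for h
    using that is_partitionD(1)[of h j "Suc j"] by (simp add: D_def flat_partitions_def less_le)
  have size: "partition_size (\<phi> h) = partition_size h + Suc j" if "h \<in> flat_partitions j" for h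
  proof -
    have fin: "finite {k. h k \<noteq> 0}"
      using that by (simp add: flat_partitions_def is_partition_def)
    define A where "A = {k. h k \<noteq> 0} \<union> {..j}"
    have "finite A" "{..j} \<subseteq> A" using fin by (auto simp: A_def)
    have "partition_size (\<phi> h) = sum (\<phi> h) A"
      using fin by (intro partition_size_eq_sum) (auto simp: A_def \<phi>_def)
    also have "\<dots> = (\<Sum>k\<in>A. h k + (if k \<in> {..j} then 1 else 0))"
      by (intro sum.cong) (auto simp: \<phi>_def)
    also have "\<dots> = sum h A + card (A \<inter> {..j})"
      using \<open>finite A\<close> by (simp only: sum.distrib sum.inter_restrict[symmetric]) simp
    also have "A \<inter> {..j} = {..j}"
      using \<open>{..j} \<subseteq> A\<close> by auto
    also have "sum h A = partition_size h"
      using fin by (intro partition_size_eq_sum[symmetric]) (auto simp: A_def)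
    finally show ?thesis by simp
  qed
  have "bij_betw \<phi> (flat_partitions j) D"
  proof (rule bij_betw_byWitness[where f' = \<psi>])
    show "\<forall>h\<in>flat_partitions j. \<psi> (\<phi> h) = h"
      by (simp add: \<phi>_def \<psi>_def fun_eq_iff)
    \<comment> \<open>The parts up to \<open>j\<close> all equal \<open>h j > h (Suc j)\<close>, so
      the truncated subtraction in \<open>\<psi>\<close> is exact.\<close>
    have pos: "h k > 0" if "h \<in> D" "k \<le> j" for h k
      using D_gt[OF that(1)] flat_partitions_const[of h j] that unfolding D_def
      by (metis (lifting) gr0I le_refl mem_Collect_eq not_less_zero)
    show "\<forall>h\<in>D. \<phi> (\<psi> h) = h"
      using pos by (auto simp: \<phi>_def \<psi>_def fun_eq_iff)
    show "\<phi> ` flat_partitions j \<subseteq> D"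
    proof clarify
      fix h
      assume h: "h \<in> flat_partitions j"
      then have part: "is_partition h" and "h j = h 0"
        by (simp_all add: flat_partitions_def)
      have "{k. \<phi> h k \<noteq> 0} \<subseteq> {k. h k \<noteq> 0} \<union> {..j}"
        by (auto simp: \<phi>_def)
      then have "finite {k. \<phi> h k \<noteq> 0}"
        by (rule finite_subset) (use is_partitionD(2)[OF part] in simp)
      moreover have "\<phi> h (Suc k) \<le> \<phi> h k" for k
        using is_partitionD(1)[OF part, of k "Suc k"] by (simp add: \<phi>_def)
      ultimately have "is_partition (\<phi> h)"
        by (intro is_partitionI)
      then show "\<phi> h \<in> D"
        using is_partitionD(1)[OF part, of j "Suc j"] \<open>h j = h 0\<close>
        by (simp add: D_def flat_partitions_def \<phi>_def)
    qed
    show "\<psi> ` D \<subseteq> flat_partitions j"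
    proof clarify
      fix h
      assume h: "h \<in> D"
      then have part: "is_partition h" and "h j = h 0"
        by (simp_all add: D_def flat_partitions_def)
      have "{k. \<psi> h k \<noteq> 0} \<subseteq> {k. h k \<noteq> 0}"
        by (auto simp: \<psi>_def)
      then have "finite {k. \<psi> h k \<noteq> 0}"
        by (rule finite_subset) (use is_partitionD(2)[OF part] in simp)
      moreover have "\<psi> h (Suc k) \<le> \<psi> h k" for k
        using D_gt[OF h] is_partitionD(1)[OF part, of k "Suc k"]
        by (cases "k = j") (auto simp: \<psi>_def)
      ultimately have "is_partition (\<psi> h)"
        by (intro is_partitionI)
      then show "\<psi> h \<in> flat_partitions j"
        using \<open>h j = h 0\<close> by (simp add: flat_partitions_def \<psi>_def)
    qed
  qed
  from this size have "(gen_fun D partition_size :: 'a fps) =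
      gen_fun (flat_partitions j) (\<lambda>h. partition_size h + Suc j)"
    by (rule gen_fun_bij_betw[where \<phi> = \<phi>])
  then have D: "(gen_fun D partition_size :: 'a fps) =
      fps_X ^ Suc j * gen_fun (flat_partitions j) partition_size"
    by (simp only: gen_fun_shift)
  have split: "flat_partitions j = flat_partitions (Suc j) \<union> D"
    using flat_partitions_const[of _ "Suc j" j] by (auto simp: flat_partitions_def D_def)
  have "flat_partitions (Suc j) \<inter> D = {}"
    using flat_partitions_const[of _ "Suc j" j] by (auto simp: flat_partitions_def D_def)
  moreover have "finite {h\<in>D. partition_size h = n}" for n
    by (rule finite_subset[OF _ finite_flat_partitions_of_size[of j n]]) (auto simp: D_def)
  ultimately have "(gen_fun (flat_partitions (Suc j) \<union> D) partition_size :: 'a fps) =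
      gen_fun (flat_partitions (Suc j)) partition_size + gen_fun D partition_size"
    by (intro gen_fun_Un finite_flat_partitions_of_size)
  then show ?thesis
    by (simp only: D flip: split)
qed

text \<open>The recurrence reads \<open>p (Suc n) = (1 - fps_X ^ Suc n) * p n\<close>, so
  \<open>p n\<close> is the finite product times \<open>p 0\<close>. Since \<open>p\<close> tends to
  \<open>1\<close>, the finite products tend to the inverse of \<open>p 0\<close>.\<close>

lemma qpoch_inf_eq_inverse_partitions:
  "qpoch_inf fps_X fps_X = inverse (gen_fun (Collect is_partition) partition_size :: rat fps)"
proof -
  define p :: "nat \<Rightarrow> rat fps" where "p = (\<lambda>j. gen_fun (flat_partitions j) partition_size)"
  have lim: "p \<longlonglongrightarrow> 1"
    unfolding p_def
  proof (rule gen_fun_LIMSEQ_1)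
    show "(\<lambda>_. 0) \<in> flat_partitions j" for j
      by (simp add: flat_partitions_def is_partition_zero)
    fix j h
    assume h: "h \<in> flat_partitions j" "h \<noteq> (\<lambda>_. 0)"
    then obtain k where "h k \<noteq> 0" by (auto simp: fun_eq_iff)
    moreover have "h k \<le> h 0" "h j = h 0"
      using h by (auto simp: flat_partitions_def is_partition_def antimonoD)
    ultimately have "h j \<noteq> 0" by simp
    moreover from this have "(j + 1) * h j \<le> partition_size h"
      using h by (intro partition_size_ge) (auto simp: flat_partitions_def)
    ultimately show "j < partition_size h"
      by (metis Suc_eq_plus1 Suc_le_eq le_trans mult.right_neutral mult_le_mono2 not_gr0
          One_nat_def)
  qed simp
  have eq: "qpoch fps_X fps_X n * p 0 = p n" for n
  proof (induction n)
    case (Suc n)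
    have "qpoch fps_X fps_X (Suc n) * p 0 = (1 - fps_X ^ Suc n) * (qpoch fps_X fps_X n * p 0)"
      by (simp add: qpoch_def mult_ac)
    also have "\<dots> = p n - fps_X ^ Suc n * p n"
      unfolding Suc.IH by (simp add: algebra_simps)
    also have "\<dots> = p (Suc n)"
      using gen_fun_flat_partitions_rec[of n, where 'a = rat] unfolding p_def
      by (metis add_diff_cancel_right')
    finally show ?case .
  qed (simp add: qpoch_def)
  have nth0: "fps_nth (p 0) 0 = 1"
  proof -
    have "{h \<in> flat_partitions 0. partition_size h = 0} = {\<lambda>_. 0}"
      using is_partition_zero by (auto simp: flat_partitions_def partition_size_def is_partition_def)
    then show ?thesis by (simp add: p_def gen_fun_nth)
  qed
  have "qpoch fps_X fps_X n = p n * inverse (p 0)" for n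
    using eq[of n] inverse_mult_eq_1'[of "p 0"] nth0
    by (metis mult.assoc mult.right_neutral zero_neq_one)
  then have "qpoch fps_X fps_X = (\<lambda>n. p n * inverse (p 0))" by auto
  moreover have "(\<lambda>n. p n * inverse (p 0)) \<longlonglongrightarrow> 1 * inverse (p 0)"
    by (intro tendsto_mult_fps tendsto_const lim)
  ultimately have "qpoch fps_X fps_X \<longlonglongrightarrow> inverse (p 0)" by simp
  then have "qpoch_inf fps_X fps_X = inverse (p 0)"
    unfolding qpoch_inf_def by (rule limI)
  moreover have "flat_partitions 0 = Collect is_partition"
    by (auto simp: flat_partitions_def)
  ultimately show ?thesis by (simp add: p_def)
qed

subsection \<open>Sets without consecutive elements\<close>

text \<open>An element \<open>y\<close> stands for the integer \<open>y + 1\<close>, hence the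
  weight \<open>sum Suc\<close>. These are the partitions into parts above \<open>j\<close> with
  differences at least 2, as in the Rogers-Ramanujan identities.\<close>

definition sparse_sets :: "nat \<Rightarrow> nat set set" where
  "sparse_sets j = {Y. finite Y \<and> Y \<subseteq> {j..} \<and> (\<forall>y\<in>Y. Suc y \<notin> Y)}"

lemma le_sum_Suc:
  assumes "finite Y" and "y \<in> Y"
  shows "y < sum Suc Y"
  using member_le_sum[of y Y Suc] assms by simp

lemma finite_sparse_sets_of_size: "finite {Y\<in>sparse_sets j. sum Suc Y = n}"
proof (rule finite_subset)
  show "{Y\<in>sparse_sets j. sum Suc Y = n} \<subseteq> Pow {..<n}"
    using le_sum_Suc by (auto simp: sparse_sets_def)
qed simp

text \<open>Split by whether \<open>j\<close> belongs to the set. If it does, it weighs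
  \<open>j + 1\<close> and excludes \<open>j + 1\<close>, so the other elements start at
  \<open>j + 2\<close>.\<close>

lemma gen_fun_sparse_sets_rec:
  "(gen_fun (sparse_sets j) (sum Suc) :: 'a::ring_1 fps) =
     gen_fun (sparse_sets (j + 1)) (sum Suc) +
     fps_X ^ (j + 1) * gen_fun (sparse_sets (j + 2)) (sum Suc)"
proof -
  define D where "D = {Y\<in>sparse_sets j. j \<in> Y}"
  have "bij_betw (insert j) (sparse_sets (j + 2)) D"
  proof (rule bij_betw_byWitness[where f' = "\<lambda>Y. Y - {j}"])
    show "\<forall>Y\<in>sparse_sets (j + 2). insert j Y - {j} = Y"
      by (auto simp: sparse_sets_def)
    show "\<forall>Y\<in>D. insert j (Y - {j}) = Y"
      by (auto simp: D_def)
    show "insert j ` sparse_sets (j + 2) \<subseteq> D"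
      by (fastforce simp: sparse_sets_def D_def)
    show "(\<lambda>Y. Y - {j}) ` D \<subseteq> sparse_sets (j + 2)"
    proof clarify
      fix Y
      assume Y: "Y \<in> D"
      have "y \<ge> j + 2" if "y \<in> Y - {j}" for y
      proof -
        have "y \<ge> j" "y \<noteq> j" "y \<noteq> Suc j"
          using Y that by (auto simp: D_def sparse_sets_def)
        then show ?thesis by simp
      qed
      then show "Y - {j} \<in> sparse_sets (j + 2)"
        using Y by (auto simp: D_def sparse_sets_def)
    qed
  qed
  moreover have "sum Suc (insert j Y) = sum Suc Y + (j + 1)" if "Y \<in> sparse_sets (j + 2)" for Y
    using that by (subst sum.insert) (auto simp: sparse_sets_def)
  ultimately have "(gen_fun D (sum Suc) :: 'a fps) =
      gen_fun (sparse_sets (j + 2)) (\<lambda>Y. sum Suc Y + (j + 1))"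
    by (rule gen_fun_bij_betw[where \<phi> = "insert j"])
  then have D: "(gen_fun D (sum Suc) :: 'a fps) =
      fps_X ^ (j + 1) * gen_fun (sparse_sets (j + 2)) (sum Suc)"
    by (simp only: gen_fun_shift)
  have "y \<ge> j + 1" if "Y \<in> sparse_sets j" "j \<notin> Y" "y \<in> Y" for y Y
  proof -
    have "y \<ge> j" "y \<noteq> j"
      using that by (auto simp: sparse_sets_def)
    then show ?thesis by simp
  qed
  then have "sparse_sets j - D \<subseteq> sparse_sets (j + 1)"
    by (force simp: sparse_sets_def D_def)
  moreover have "sparse_sets (j + 1) \<subseteq> sparse_sets j - D"
    by (force simp: sparse_sets_def D_def)
  moreover have "D \<subseteq> sparse_sets j"
    by (auto simp: D_def)
  ultimately have split: "sparse_sets j = sparse_sets (j + 1) \<union> D"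
    and "sparse_sets (j + 1) \<inter> D = {}"
    by auto
  moreover have "finite {Y\<in>D. sum Suc Y = n}" for n
    by (rule finite_subset[OF _ finite_sparse_sets_of_size[of j n]]) (auto simp: D_def)
  ultimately have "(gen_fun (sparse_sets (j + 1) \<union> D) (sum Suc) :: 'a fps) =
      gen_fun (sparse_sets (j + 1)) (sum Suc) + gen_fun D (sum Suc)"
    by (intro gen_fun_Un finite_sparse_sets_of_size)
  then show ?thesis
    by (simp only: D flip: split)
qed

subsection \<open>Interleaving the rows\<close>

definition zigzag_seqs :: "(nat \<Rightarrow> nat) set" where
  "zigzag_seqs = {f. finite {k. f k \<noteq> 0} \<and> (\<forall>k. f (k + 2) \<le> f k \<and> f (k + 3) \<le> f k)}"

text \<open>Putting the rows in the order 2, 1, 3 makes each of the three inequalities between rows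
  a step of 2 in \<open>f\<close>, while a step of 3 stays within a row.\<close>

definition weave :: "(nat \<Rightarrow> nat) \<Rightarrow> (nat \<Rightarrow> nat) list" where
  "weave f = [\<lambda>j. f (3 * j + 1), \<lambda>j. f (3 * j), \<lambda>j. f (3 * j + 2)]"

definition unweave :: "(nat \<Rightarrow> nat) list \<Rightarrow> nat \<Rightarrow> nat" where
  "unweave L k = (L ! ([1, 0, 2] ! (k mod 3))) (k div 3)"

lemma unweave_simps:
  "unweave L (3 * j) = (L ! 1) j"
  "unweave L (3 * j + 1) = (L ! 0) j"
  "unweave L (3 * j + 2) = (L ! 2) j"
proof -
  have "(3 * j + 1) div 3 = j" "(3 * j + 1) mod 3 = 1" "(3 * j + 2) div 3 = j" "(3 * j + 2) mod 3 = 2"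
    by presburger+
  then show "unweave L (3 * j) = (L ! 1) j"
    "unweave L (3 * j + 1) = (L ! 0) j"
    "unweave L (3 * j + 2) = (L ! 2) j"
    by (simp_all only: unweave_def) simp_all
qed

lemma mod_3_cases:
  fixes k :: nat
  obtains j where "k = 3 * j" | j where "k = 3 * j + 1" | j where "k = 3 * j + 2"
proof -
  have "k = 3 * (k div 3) + k mod 3" "k mod 3 = 0 \<or> k mod 3 = 1 \<or> k mod 3 = 2"
    by auto
  then show thesis
    using that by (metis add.right_neutral)
qed

lemma cylindric_partitions_110_iff:
  "L \<in> cylindric_partitions [1, 1, 0] \<longleftrightarrow>
     (\<exists>l1 l2 l3. L = [l1, l2, l3] \<and> is_partition l1 \<and> is_partition l2 \<and> is_partition l3 \<and>
       (\<forall>j. l2 (j + 1) \<le> l1 j \<and> l3 j \<le> l2 j \<and> l1 (j + 1) \<le> l3 j))"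
  (is "?l \<longleftrightarrow> ?r")
proof
  assume l: ?l
  then have "length L = 3"
    by (simp add: cylindric_partitions_def)
  then obtain l1 l2 l3 where L: "L = [l1, l2, l3]"
    by (auto simp: numeral_3_eq_3 length_Suc_conv)
  have *: "\<And>i j. i < 2 \<Longrightarrow> (L ! (i + 1)) (j + [1, 1, 0] ! (i + 1)) \<le> (L ! i) j"
    using l by (simp add: cylindric_partitions_def)
  have "l2 (j + 1) \<le> l1 j" "l3 j \<le> l2 j" for j
    using *[of 0 j] *[of 1 j] by (simp_all add: L)
  moreover have "l1 (j + 1) \<le> l3 j" for j
    using l by (simp add: L cylindric_partitions_def)
  ultimately show ?r
    using l by (auto simp: L cylindric_partitions_def)
next
  assume ?r
  then show ?l
    by (auto simp: cylindric_partitions_def less_Suc_eq)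
qed

lemma bij_betw_weave: "bij_betw weave zigzag_seqs (cylindric_partitions [1, 1, 0])"
proof (rule bij_betw_byWitness[where f' = unweave])
  show "\<forall>f\<in>zigzag_seqs. unweave (weave f) = f"
  proof (intro ballI ext)
    fix f k
    show "unweave (weave f) k = f k"
      by (cases k rule: mod_3_cases) (simp_all add: unweave_simps[simplified] weave_def)
  qed
  show "\<forall>L\<in>cylindric_partitions [1, 1, 0]. weave (unweave L) = L"
    by (auto simp: cylindric_partitions_110_iff[unfolded One_nat_def] weave_def
        unweave_simps[simplified])
  show "weave ` zigzag_seqs \<subseteq> cylindric_partitions [1, 1, 0]"
  proof clarify
    fix f
    assume f: "f \<in> zigzag_seqs"
    then have fin: "finite {k. f k \<noteq> 0}" and 2: "\<And>k. f (k + 2) \<le> f k" and 3: "\<And>k. f (k + 3) \<le> f k"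
      by (auto simp: zigzag_seqs_def)
    have part: "is_partition (\<lambda>j. f (3 * j + r))" for r
    proof (rule is_partitionI)
      show "f (3 * Suc k + r) \<le> f (3 * k + r)" for k
        using 3[of "3 * k + r"] by (simp add: add_ac)
      have "inj (\<lambda>j. 3 * j + r)"
        by (auto simp: inj_on_def)
      from finite_vimageI[OF fin this] show "finite {j. f (3 * j + r) \<noteq> 0}"
        by (simp add: vimage_def)
    qed
    have "f (3 * (j + 1)) \<le> f (3 * j + 1)" "f (3 * j + 2) \<le> f (3 * j)"
      "f (3 * (j + 1) + 1) \<le> f (3 * j + 2)" for j
      using 2[of "3 * j + 1"] 2[of "3 * j"] 2[of "3 * j + 2"] by (simp_all add: numeral_eq_Suc)
    then show "weave f \<in> cylindric_partitions [1, 1, 0]"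
      unfolding cylindric_partitions_110_iff weave_def
      using part[of 0] part[of 1] part[of 2] by auto
  qed
  show "unweave ` cylindric_partitions [1, 1, 0] \<subseteq> zigzag_seqs"
  proof (clarsimp simp: cylindric_partitions_110_iff[unfolded One_nat_def])
    fix l1 l2 l3
    assume part: "is_partition l1" "is_partition l2" "is_partition l3"
      and ineq: "\<forall>j. l2 (Suc j) \<le> l1 j \<and> l3 j \<le> l2 j \<and> l1 (Suc j) \<le> l3 j"
    define f where "f = unweave [l1, l2, l3]"
    have f: "f (3 * j) = l2 j" "f (3 * j + 1) = l1 j" "f (3 * j + 2) = l3 j" for j
      unfolding f_def by (simp_all add: unweave_simps[simplified])
    have "{k. f k \<noteq> 0} \<subseteq> (\<lambda>j. 3 * j) ` {j. l2 j \<noteq> 0} \<union> (\<lambda>j. 3 * j + 1) ` {j. l1 j \<noteq> 0} \<union>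
        (\<lambda>j. 3 * j + 2) ` {j. l3 j \<noteq> 0}"
    proof
      fix k
      assume "k \<in> {k. f k \<noteq> 0}"
      then show "k \<in> (\<lambda>j. 3 * j) ` {j. l2 j \<noteq> 0} \<union> (\<lambda>j. 3 * j + 1) ` {j. l1 j \<noteq> 0} \<union>
        (\<lambda>j. 3 * j + 2) ` {j. l3 j \<noteq> 0}"
        by (cases k rule: mod_3_cases) (auto simp: f f[simplified])
    qed
    then have "finite {k. f k \<noteq> 0}"
      by (rule finite_subset) (use part is_partitionD(2) in auto)
    \<comment> \<open>From residues 1 and 2 the step enters the next column, matching the profile
      entries 1; from residue 0 it stays in the column, matching the entry 0.\<close>
    moreover have "f (k + 2) \<le> f k" for k
    proof (cases k rule: mod_3_cases)
      case (1 j)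
      then show ?thesis using f ineq by simp
    next
      case (2 j)
      then have "k + 2 = 3 * Suc j" by simp
      then show ?thesis unfolding 2 using f ineq by metis
    next
      case (3 j)
      then have "k + 2 = 3 * Suc j + 1" by simp
      then show ?thesis unfolding 3 using f ineq by metis
    qed
    moreover have "f (k + 3) \<le> f k" for k
    proof (cases k rule: mod_3_cases)
      case (1 j)
      then have shift: "k + 3 = 3 * Suc j" by simp
      show ?thesis
        unfolding shift unfolding 1 f using is_partitionD(1)[OF part(2)] by simp
    next
      case (2 j)
      then have shift: "k + 3 = 3 * Suc j + 1" by simp
      show ?thesis
        unfolding shift unfolding 2 f using is_partitionD(1)[OF part(1)] by simp
    next
      case (3 j)
      then have shift: "k + 3 = 3 * Suc j + 2" by simp
      show ?thesis
        unfolding shift unfolding 3 f using is_partitionD(1)[OF part(3)] by simp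
    qed
    ultimately show "unweave [l1, l2, l3] \<in> zigzag_seqs"
      by (simp add: zigzag_seqs_def f_def)
  qed
qed

lemma cylindric_size_weave:
  assumes "f \<in> zigzag_seqs"
  shows "cylindric_size (weave f) = partition_size f"
proof -
  obtain M where M: "{k. f k \<noteq> 0} \<subseteq> {..<M}"
    using assms finite_nat_iff_bounded by (auto simp: zigzag_seqs_def)
  \<comment> \<open>A cutoff at a multiple of 3 lets the sum split into full columns.\<close>
  have "{..<M} \<subseteq> {..<3 * M}"
    by auto
  then have "partition_size f = sum f {..<3 * M}"
    using M by (intro partition_size_eq_sum) auto
  also have "\<dots> = (\<Sum>j<M. f (3 * j + 1)) + (\<Sum>j<M. f (3 * j)) + (\<Sum>j<M. f (3 * j + 2))"
    by (induction M) (simp_all add: numeral_3_eq_3)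
  also have "(\<Sum>j<M. f (3 * j + r)) = partition_size (\<lambda>j. f (3 * j + r))" for r
    using M by (intro partition_size_eq_sum[symmetric]) auto
  note this[of 1]
  also have "(\<Sum>j<M. f (3 * j + 2)) = partition_size (\<lambda>j. f (3 * j + 2))"
    using M by (intro partition_size_eq_sum[symmetric]) auto
  also have "(\<Sum>j<M. f (3 * j)) = partition_size (\<lambda>j. f (3 * j))"
    using M by (intro partition_size_eq_sum[symmetric]) auto
  finally show ?thesis
    by (simp add: cylindric_size_def weave_def)
qed

subsection \<open>Sorting\<close>

text \<open>The product of the transpositions of \<open>y\<close> and \<open>y + 1\<close> for
  \<open>y\<close> in \<open>Y\<close>. They are disjoint when \<open>Y\<close> has no consecutive
  elements, which makes this an involution.\<close>

definition swap_at :: "nat set \<Rightarrow> nat \<Rightarrow> nat" where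
  "swap_at Y k = (if k \<in> Y then Suc k else if k > 0 \<and> k - 1 \<in> Y then k - 1 else k)"

lemma swap_at_swap_at:
  assumes "\<forall>y\<in>Y. Suc y \<notin> Y"
  shows "swap_at Y (swap_at Y k) = k"
  using assms by (cases k) (auto simp: swap_at_def)

lemma bij_swap_at:
  assumes "\<forall>y\<in>Y. Suc y \<notin> Y"
  shows "bij (swap_at Y)"
  by (rule bij_betw_byWitness[where f' = "swap_at Y"]) (auto simp: swap_at_swap_at[OF assms])

text \<open>Here \<open>partition_size\<close> is also applied to sequences that are not sorted,
  such as the elements of \<open>zigzag_seqs\<close>.\<close>

lemma partition_size_comp_bij:
  assumes "bij \<sigma>"
  shows "partition_size (\<lambda>k. f (\<sigma> k)) = partition_size f"
proof -
  have "\<sigma> ` {j. f (\<sigma> j) \<noteq> 0} = {j. f j \<noteq> 0}"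
    using surj_image_vimage_eq[OF bij_is_surj[OF assms], of "{j. f j \<noteq> 0}"] by (simp add: vimage_def)
  then have "bij_betw \<sigma> {j. f (\<sigma> j) \<noteq> 0} {j. f j \<noteq> 0}"
    using bij_is_inj[OF assms] by (auto simp: bij_betw_def intro: inj_on_subset)
  then show ?thesis
    unfolding partition_size_def by (rule sum.reindex_bij_betw)
qed

text \<open>As a function of \<open>k\<close>, this is the conjugate of the partition with parts
  \<open>y + 1\<close> for \<open>y\<close> in \<open>Y\<close>; it drops by one exactly after each
  \<open>y\<close> in \<open>Y\<close>.\<close>

definition count_ge :: "nat set \<Rightarrow> nat \<Rightarrow> nat" where
  "count_ge Y k = card {y\<in>Y. k \<le> y}"

lemma count_ge_eq_0:
  assumes "Y \<subseteq> {..<k}"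
  shows "count_ge Y k = 0"
proof -
  have "{y\<in>Y. k \<le> y} = {}"
    using assms by auto
  then show ?thesis
    by (simp only: count_ge_def card.empty)
qed

lemma count_ge_Suc:
  assumes "finite Y"
  shows "count_ge Y k = count_ge Y (Suc k) + (if k \<in> Y then 1 else 0)"
proof -
  have "{y\<in>Y. k \<le> y} = {y\<in>Y. Suc k \<le> y} \<union> (if k \<in> Y then {k} else {})"
    by (auto simp: Suc_le_eq le_less)
  then show ?thesis
    using assms by (simp add: count_ge_def)
qed

text \<open>Double counting: \<open>y\<close> is counted for \<open>k = 0, ..., y\<close>, hence
  \<open>y + 1\<close> times.\<close>

lemma sum_count_ge:
  assumes "finite Y" and "Y \<subseteq> {..<M}"
  shows "(\<Sum>k<M. count_ge Y k) = sum Suc Y"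
proof -
  have "(\<Sum>k<M. count_ge Y k) = (\<Sum>k<M. \<Sum>y\<in>Y. if k \<le> y then 1 else 0)"
    using assms(1) by (simp add: count_ge_def sum.inter_filter[symmetric])
  also have "\<dots> = (\<Sum>y\<in>Y. \<Sum>k<M. if k \<le> y then 1 else 0)"
    by (rule sum.swap)
  also have "\<dots> = (\<Sum>y\<in>Y. Suc y)"
  proof (rule sum.cong)
    fix y
    assume "y \<in> Y"
    then have "{k\<in>{..<M}. k \<le> y} = {..y}"
      using assms(2) by auto
    then show "(\<Sum>k<M. if k \<le> y then 1 else 0) = Suc y"
      by (simp add: sum.inter_filter[symmetric])
  qed simp
  finally show ?thesis .
qed

text \<open>Adding \<open>count_ge Y\<close> forces a strict drop of the partition at each element
  of \<open>Y\<close>; the swaps then turn exactly these drops into ascents, from which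
  \<open>split_seq\<close> recovers \<open>Y\<close>.\<close>

definition merge :: "nat set \<times> (nat \<Rightarrow> nat) \<Rightarrow> nat \<Rightarrow> nat" where
  "merge = (\<lambda>(Y, h) k. h (swap_at Y k) + count_ge Y (swap_at Y k))"

definition ascents :: "(nat \<Rightarrow> nat) \<Rightarrow> nat set" where
  "ascents f = {k. f k < f (Suc k)}"

definition split_seq :: "(nat \<Rightarrow> nat) \<Rightarrow> nat set \<times> (nat \<Rightarrow> nat)" where
  "split_seq f = (ascents f, \<lambda>k. f (swap_at (ascents f) k) - count_ge (ascents f) k)"

lemma partition_size_merge:
  assumes "Y \<in> sparse_sets j" and "is_partition h"
  shows "partition_size (merge (Y, h)) = sum Suc Y + partition_size h"
proof -
  have Y: "finite Y" "\<forall>y\<in>Y. Suc y \<notin> Y"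
    using assms by (auto simp: sparse_sets_def)
  obtain M where M: "Y \<union> {k. h k \<noteq> 0} \<subseteq> {..<M}"
    using Y(1) is_partitionD(2)[OF assms(2)] finite_nat_iff_bounded by (metis finite_UnI)
  have "count_ge Y k = 0" if "k \<ge> M" for k
    using M that by (intro count_ge_eq_0) auto
  then have supp: "{k. h k + count_ge Y k \<noteq> 0} \<subseteq> {..<M}"
    using M by (auto simp: not_less[symmetric])
  have "partition_size (merge (Y, h)) = partition_size (\<lambda>k. h k + count_ge Y k)"
    using partition_size_comp_bij[OF bij_swap_at[OF Y(2)], of "\<lambda>k. h k + count_ge Y k"]
    by (simp add: merge_def)
  also have "\<dots> = (\<Sum>k<M. h k) + (\<Sum>k<M. count_ge Y k)"
    using supp by (subst partition_size_eq_sum[of "{..<M}"]) (auto simp: sum.distrib)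
  also have "(\<Sum>k<M. h k) = partition_size h"
    using M by (intro partition_size_eq_sum[symmetric]) auto
  also have "(\<Sum>k<M. count_ge Y k) = sum Suc Y"
    using Y M by (intro sum_count_ge) auto
  finally show ?thesis by simp
qed

lemma
  assumes Y: "Y \<in> sparse_sets 0" and h: "is_partition h"
  shows merge_in_zigzag_seqs: "merge (Y, h) \<in> zigzag_seqs"
    and split_seq_merge: "split_seq (merge (Y, h)) = (Y, h)"
proof -
  have fin: "finite Y" and sparse: "\<forall>y\<in>Y. Suc y \<notin> Y"
    using Y by (auto simp: sparse_sets_def)
  note inv = swap_at_swap_at[OF sparse]
  define g where "g = (\<lambda>k. h k + count_ge Y k)"
  define f where "f = merge (Y, h)"
  have f: "f k = g (swap_at Y k)" for k
    by (simp add: f_def g_def merge_def)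
  have g_step: "g (Suc k) + (if k \<in> Y then 1 else 0) \<le> g k" for k
    using count_ge_Suc[OF fin, of k] is_partitionD(1)[OF h, of k "Suc k"] by (simp add: g_def)
  have g_mono: "g j \<le> g i" if "i \<le> j" for i j
    using that
  proof (induction rule: dec_induct)
    case (step n)
    then show ?case
      using g_step[of n] by simp
  qed simp
  have "{k. g k \<noteq> 0} \<subseteq> {k. h k \<noteq> 0} \<union> {k. \<exists>y\<in>Y. k \<le> y}"
    using fin by (auto simp: g_def count_ge_def)
  moreover have "finite {k. \<exists>y\<in>Y. k \<le> y}"
  proof -
    have "{k. \<exists>y\<in>Y. k \<le> y} = (\<Union>y\<in>Y. {..y})"
      by auto
    then show ?thesis
      using fin by simp
  qed
  ultimately have "finite {k. g k \<noteq> 0}"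
    using is_partitionD(2)[OF h] by (meson finite_UnI finite_subset)
  from finite_vimageI[OF this bij_is_inj[OF bij_swap_at[OF sparse]]]
  have "finite {k. f k \<noteq> 0}"
    by (simp add: f vimage_def)
  \<comment> \<open>\<open>swap_at Y\<close> moves an index by at most one: \<open>k\<close> goes to
    at most \<open>k + 1\<close>, while \<open>k + 2\<close> and \<open>k + 3\<close> go to at least
    \<open>k + 1\<close>.\<close>
  moreover have "f (k + 2) \<le> f k" "f (k + 3) \<le> f k" for k
    unfolding f by (intro g_mono; auto simp: swap_at_def)+
  ultimately show "merge (Y, h) \<in> zigzag_seqs"
    by (simp add: zigzag_seqs_def f_def)
  have "ascents f = Y"
  proof (intro set_eqI)
    fix k
    show "k \<in> ascents f \<longleftrightarrow> k \<in> Y"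
    proof (cases "k \<in> Y")
      case True
      then have "swap_at Y k = Suc k" "swap_at Y (Suc k) = k"
        using sparse by (auto simp: swap_at_def)
      then show ?thesis
        using True g_step[of k] by (simp add: ascents_def f)
    next
      case False
      \<comment> \<open>For \<open>k\<close> outside \<open>Y\<close>, \<open>k\<close> is not moved
        up and \<open>Suc k\<close> is not moved down, so no ascent arises.\<close>
      then have "swap_at Y k \<le> swap_at Y (Suc k)"
        by (auto simp: swap_at_def)
      then show ?thesis
        using False g_mono by (simp add: ascents_def f not_less)
    qed
  qed
  then show "split_seq (merge (Y, h)) = (Y, h)"
    unfolding split_seq_def f_def[symmetric] by (simp add: f inv) (simp add: g_def)
qed

text \<open>Two adjacent ascents would contradict \<open>f (k + 2) \<le> f k\<close>, so the swaps
  are disjoint. The swapped sequence \<open>u\<close> is antitone and drops strictly at every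
  ascent, which leaves room to subtract \<open>count_ge Y\<close>.\<close>

lemma
  assumes f: "f \<in> zigzag_seqs"
  shows split_seq_in: "split_seq f \<in> sparse_sets 0 \<times> Collect is_partition"
    and merge_split_seq: "merge (split_seq f) = f"
proof -
  have supp: "finite {k. f k \<noteq> 0}" and f2: "\<And>k. f (k + 2) \<le> f k" and f3: "\<And>k. f (k + 3) \<le> f k"
    using f by (auto simp: zigzag_seqs_def)
  define Y where "Y = ascents f"
  define u where "u = (\<lambda>k. f (swap_at Y k))"
  have "Y \<subseteq> Suc -` {k. f k \<noteq> 0}"
    by (auto simp: Y_def ascents_def)
  then have fin: "finite Y"
    using finite_vimageI[OF supp, of Suc] finite_subset by auto
  have sparse: "\<forall>y\<in>Y. Suc y \<notin> Y"
  proof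
    fix y
    assume "y \<in> Y"
    then show "Suc y \<notin> Y"
      using f2[of y] by (simp add: Y_def ascents_def)
  qed
  note inv = swap_at_swap_at[OF sparse]
  have u_step: "u (Suc k) + (if k \<in> Y then 1 else 0) \<le> u k" for k
  proof (cases "k \<in> Y")
    case True
    then have "swap_at Y k = Suc k" "swap_at Y (Suc k) = k"
      using sparse by (auto simp: swap_at_def)
    then show ?thesis
      using True by (simp add: u_def Y_def ascents_def)
  next
    case False
    then have 1: "f (Suc k) \<le> f k"
      by (simp add: Y_def ascents_def)
    show ?thesis
    proof (cases "k > 0 \<and> k - 1 \<in> Y")
      case True
      then obtain i where "k = Suc i" "i \<in> Y"
        by (cases k) auto
      \<comment> \<open>Here \<open>u k = f i\<close>, and \<open>u (Suc k)\<close> is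
        \<open>f (i + 3)\<close> or \<open>f (i + 2)\<close> according to whether
        \<open>i + 2\<close> is an ascent as well.\<close>
      then show ?thesis
        using False f2[of i] f3[of i] by (simp add: u_def swap_at_def numeral_3_eq_3)
    next
      case not_prev: False
      then show ?thesis
        using False f2[of k] 1 by (auto simp: u_def swap_at_def)
    qed
  qed
  \<comment> \<open>Downward induction from a bound \<open>M\<close> of \<open>Y\<close>, where the
    count vanishes: at each step \<open>u\<close> drops by at least as much as
    \<open>count_ge Y\<close>. Thus the truncated subtraction in \<open>split_seq\<close> is
    exact.\<close>
  have le: "count_ge Y k \<le> u k" for k
  proof -
    obtain M where M: "Y \<subseteq> {..<M}"
      using fin finite_nat_iff_bounded by blast
    have zero: "count_ge Y k = 0" if "k \<ge> M" for k
      using M that by (intro count_ge_eq_0) auto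
    show ?thesis
    proof (cases "k \<le> M")
      case True
      then show ?thesis
      proof (induction k rule: inc_induct)
        case base
        show ?case by (simp add: zero)
      next
        case (step k)
        then show ?case
          using u_step[of k] count_ge_Suc[OF fin, of k] by simp
      qed
    qed (simp add: zero)
  qed
  have "is_partition (\<lambda>k. u k - count_ge Y k)"
  proof (rule is_partitionI)
    show "u (Suc k) - count_ge Y (Suc k) \<le> u k - count_ge Y k" for k
      using u_step[of k] count_ge_Suc[OF fin, of k] by simp
    have "finite {k. u k \<noteq> 0}"
      using finite_vimageI[OF supp bij_is_inj[OF bij_swap_at[OF sparse]]]
      by (simp add: u_def vimage_def)
    then show "finite {k. u k - count_ge Y k \<noteq> 0}"
      by (rule rev_finite_subset) auto
  qed
  then show "split_seq f \<in> sparse_sets 0 \<times> Collect is_partition"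
    using fin sparse by (simp add: split_seq_def sparse_sets_def Y_def u_def)
  show "merge (split_seq f) = f"
  proof
    fix k
    have "merge (split_seq f) k = u (swap_at Y k) - count_ge Y (swap_at Y k) + count_ge Y (swap_at Y k)"
      by (simp add: merge_def split_seq_def Y_def u_def)
    also have "\<dots> = u (swap_at Y k)"
      using le by simp
    also have "\<dots> = f k"
      by (simp add: u_def inv)
    finally show "merge (split_seq f) k = f k" .
  qed
qed

lemma bij_betw_merge: "bij_betw merge (sparse_sets 0 \<times> Collect is_partition) zigzag_seqs"
proof (rule bij_betw_byWitness[where f' = split_seq])
  show "split_seq ` zigzag_seqs \<subseteq> sparse_sets 0 \<times> Collect is_partition"
    by (rule image_subsetI) (rule split_seq_in)
qed (auto simp: merge_in_zigzag_seqs split_seq_merge merge_split_seq)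

lemma has_sum_cylindric_partitions_110:
  "((\<lambda>L. fps_X ^ cylindric_size L) has_sum
     (gen_fun (sparse_sets 0) (sum Suc) * gen_fun (Collect is_partition) partition_size :: 'a::ring_1 fps))
     (cylindric_partitions [1, 1, 0])"
proof -
  let ?s = "\<lambda>x. sum Suc (fst x) + partition_size (snd x)"
  let ?A = "sparse_sets 0 \<times> Collect is_partition"
  have bij: "bij_betw (weave \<circ> merge) ?A (cylindric_partitions [1, 1, 0])"
    by (rule bij_betw_trans[OF bij_betw_merge bij_betw_weave])
  have size: "cylindric_size ((weave \<circ> merge) x) = ?s x" if "x \<in> ?A" for x
    using that by (auto simp: cylindric_size_weave merge_in_zigzag_seqs partition_size_merge)
  have fin: "finite {x\<in>?A. ?s x = n}" for n
    by (rule finite_fibre_Times[OF finite_sparse_sets_of_size finite_partitions_of_size])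
  have "finite {L\<in>cylindric_partitions [1, 1, 0]. cylindric_size L = n}" for n
    using bij_betw_finite[OF bij_betw_fibre[where \<phi> = "weave \<circ> merge" and t = cylindric_size and s = ?s and n = n, OF bij size]]
      fin[of n] by simp
  then have "((\<lambda>L. fps_X ^ cylindric_size L) has_sum
      (gen_fun (cylindric_partitions [1, 1, 0]) cylindric_size :: 'a fps)) (cylindric_partitions [1, 1, 0])"
    by (rule has_sum_gen_fun)
  also have "gen_fun (cylindric_partitions [1, 1, 0]) cylindric_size = (gen_fun ?A ?s :: 'a fps)"
    by (rule gen_fun_bij_betw[where \<phi> = "weave \<circ> merge", OF bij]) (rule size)
  also have "\<dots> = gen_fun (sparse_sets 0) (sum Suc) * gen_fun (Collect is_partition) partition_size"
    by (rule gen_fun_Times[OF finite_sparse_sets_of_size finite_partitions_of_size])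
  finally show ?thesis .
qed

subsection \<open>The \<open>q\<close>-series\<close>

text \<open>With \<open>z = q\<^bsup>2i\<^esup>\<close>, these are the summands of
  \<open>\<Sum>n. z\<^sup>n q\<^bsup>n\<^sup>2\<^esup> (-z q\<^bsup>2n+2\<^esup>; q\<^sup>2)\<^sub>\<infinity> / (q\<^sup>2; q\<^sup>2)\<^sub>n\<close>, divided by \<open>(-q\<^sup>2; q\<^sup>2)\<^sub>\<infinity>\<close>.\<close>

definition rr_term :: "nat \<Rightarrow> nat \<Rightarrow> rat fps" where
  "rr_term i n = fps_X ^ (2 * i * n + n\<^sup>2) *
     inverse (qpoch (fps_X\<^sup>2) (fps_X\<^sup>2) n * qpoch (- (fps_X\<^sup>2)) (fps_X\<^sup>2) (n + i))"

definition rr_sum :: "nat \<Rightarrow> rat fps" where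
  "rr_sum i = (\<Sum>n. rr_term i n)"

lemma rr_term_sums: "rr_term i sums rr_sum i"
proof -
  have "summable (rr_term i)"
  proof (rule summable_fps)
    fix n k :: nat
    assume "k \<le> n"
    moreover have "Suc n \<le> (Suc n)\<^sup>2"
      by (simp add: power2_eq_square)
    ultimately show "fps_nth (rr_term i (Suc n)) k = 0"
      by (simp add: rr_term_def fps_X_power_mult_nth del: power_Suc)
  qed
  then show ?thesis
    unfolding rr_sum_def by (rule summable_sums)
qed

text \<open>\<open>v\<close> is a telescoping certificate: \<open>v n\<close> is
  \<open>rr_term i n\<close> times \<open>(1 - x ^ (2 * n)) / (1 + x ^ (2 * n + 2 * i + 2))\<close>.
  Over a common denominator, the claim becomes a polynomial identity.\<close>

lemma rr_term_telescope:
  fixes i :: nat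
  defines "v \<equiv> \<lambda>n. (1 - fps_X ^ (2 * n)) * fps_X ^ (2 * i * n + n\<^sup>2) *
    inverse (qpoch (fps_X\<^sup>2) (fps_X\<^sup>2) n * qpoch (- (fps_X\<^sup>2)) (fps_X\<^sup>2) (n + i + 1)) :: rat fps"
  shows "rr_term i n - (1 + fps_X ^ (2 * i + 1) + fps_X ^ (2 * i + 2)) * rr_term (i + 1) n +
    fps_X ^ (4 * i + 5) * rr_term (i + 2) n = v n - v (Suc n)"
proof -
  define x :: "rat fps" where "x = fps_X"
  define D where "D = (\<lambda>n. qpoch (x\<^sup>2) (x\<^sup>2) n)"
  define B where "B = (\<lambda>n. qpoch (- (x\<^sup>2)) (x\<^sup>2) n)"
  have x0: "fps_nth x 0 = 0"
    by (simp add: x_def)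
  have D0: "fps_nth (D n) 0 \<noteq> 0" and B0: "fps_nth (B n) 0 \<noteq> 0" for n
    unfolding D_def B_def by (subst qpoch_fps_nth_0; simp add: x0 power2_eq_square)+
  have inv: "inverse (f::rat fps) = g * inverse (f * g)" if "fps_nth g 0 \<noteq> 0" for f g
    using inverse_mult_eq_1'[OF that] by (simp add: fps_inverse_mult mult.left_commute)
  define P where "P = 1 + x ^ (2 * n + 2 * i + 2)"
  define Q where "Q = 1 + x ^ (2 * n + 2 * i + 4)"
  define R where "R = 1 - x ^ (2 * n + 2)"
  have R0: "fps_nth R 0 \<noteq> 0" and P0: "fps_nth P 0 \<noteq> 0" and Q0: "fps_nth Q 0 \<noteq> 0"
    by (simp_all add: P_def Q_def R_def x_def)
  have D: "D (Suc n) = D n * R"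
    by (simp add: D_def R_def qpoch_Suc add.commute flip: power_mult power_add)
  have B1: "B (n + (i + 1)) = B (n + i) * P"
    by (simp add: B_def P_def qpoch_Suc ac_simps flip: power_mult power_add)
  have B2: "B (n + (i + 2)) = B (n + i) * P * Q"
  proof -
    have "x\<^sup>2 * (x\<^sup>2) ^ (n + (i + 1)) = x ^ (2 + 2 * (n + (i + 1)))"
      by (simp only: power_mult power_add)
    also have "2 + 2 * (n + (i + 1)) = 2 * n + 2 * i + 4"
      by simp
    finally have "B (Suc (n + (i + 1))) = B (n + (i + 1)) * Q"
      by (simp only: B_def Q_def qpoch_Suc) simp
    then have "B (n + (i + 2)) = B (n + (i + 1)) * Q"
      by simp
    then show ?thesis
      by (simp only: B1)
  qed
  \<comment> \<open>The common factor: its denominator is that of \<open>rr_term (i + 2) n\<close>,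
    the largest among the three summands.\<close>
  define U where "U = x ^ (2 * i * n + n\<^sup>2) * inverse (D n * (B (n + i) * P * Q))"
  have e: "inverse (D n * B (n + i)) = P * Q * inverse (D n * (B (n + i) * P * Q))"
    using inv[of "P * Q" "D n * B (n + i)"] P0 Q0 by (simp add: mult_ac)
  have e1: "inverse (D n * (B (n + i) * P)) = Q * inverse (D n * (B (n + i) * P * Q))"
    using inv[of "Q" "D n * (B (n + i) * P)"] Q0 by (simp add: mult_ac)
  \<comment> \<open>The factor \<open>R\<close> in the numerator of \<open>v (Suc n)\<close> cancels
    the last factor of \<open>D (Suc n)\<close>, so \<open>v (Suc n)\<close> is a multiple of
    \<open>U\<close> too.\<close>
  have e2: "R * inverse (D n * R * (B (n + i) * P * Q)) = inverse (D n * (B (n + i) * P * Q))"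
    using inv[of R "D n * (B (n + i) * P * Q)"] R0 by (simp add: mult_ac)
  have t0: "rr_term i n = P * Q * U"
    unfolding rr_term_def x_def[symmetric] D_def[symmetric] B_def[symmetric] U_def
    by (subst e) (simp add: mult_ac)
  have t1: "rr_term (i + 1) n = x ^ (2 * n) * Q * U"
    unfolding rr_term_def x_def[symmetric] U_def
    unfolding D_def[symmetric, THEN fun_cong, simplified] B_def[symmetric, THEN fun_cong, simplified] B1
    by (subst e1) (simp add: algebra_simps power_add)
  have t2: "rr_term (i + 2) n = x ^ (4 * n) * U"
    unfolding rr_term_def x_def[symmetric] U_def
    unfolding D_def[symmetric, THEN fun_cong, simplified] B_def[symmetric, THEN fun_cong, simplified] B2
    by (simp add: algebra_simps power_add)
  have v0: "v n = (1 - x ^ (2 * n)) * Q * U"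
    unfolding v_def x_def[symmetric] U_def
    unfolding D_def[symmetric, THEN fun_cong, simplified] B_def[symmetric, THEN fun_cong, simplified]
    using e1 B1 by (simp add: mult_ac)
  have "x ^ (2 * i * Suc n + (Suc n)\<^sup>2) = x ^ (2 * i * n + n\<^sup>2) * x ^ (2 * i + 1) * x ^ (2 * n)"
    by (simp add: power_add[symmetric] power2_eq_square algebra_simps)
  then have "v (Suc n) = x ^ (2 * i * n + n\<^sup>2) * x ^ (2 * i + 1) * x ^ (2 * n) *
      (R * inverse (D n * R * (B (n + i) * P * Q)))"
    unfolding v_def x_def[symmetric]
    unfolding D_def[symmetric, THEN fun_cong, simplified] B_def[symmetric, THEN fun_cong, simplified] D
    using B2 by (simp add: mult_ac R_def del: power_Suc mult_Suc_right)
  then have v1: "v (Suc n) = x ^ (2 * i + 1) * x ^ (2 * n) * U"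
    unfolding e2 U_def by (simp add: mult_ac)
  have "P * Q - (1 + x ^ (2 * i + 1) + x ^ (2 * i + 2)) * (x ^ (2 * n) * Q) + x ^ (4 * i + 5) * x ^ (4 * n)
      = (1 - x ^ (2 * n)) * Q - x ^ (2 * i + 1) * x ^ (2 * n)"
    unfolding P_def Q_def
    by (simp add: algebra_simps power_add[symmetric] flip: power_Suc)
  then have "(P * Q - (1 + x ^ (2 * i + 1) + x ^ (2 * i + 2)) * (x ^ (2 * n) * Q) + x ^ (4 * i + 5) * x ^ (4 * n)) * U
      = ((1 - x ^ (2 * n)) * Q - x ^ (2 * i + 1) * x ^ (2 * n)) * U"
    by simp
  then show ?thesis
    unfolding t0 t1 t2 v0 v1 x_def[symmetric] by (simp add: algebra_simps)
qed

text \<open>Summing the telescoping relation over \<open>k < n\<close> leaves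
  \<open>v 0 - v n\<close>. Here \<open>v 0 = 0\<close> by the factor \<open>1 - fps_X ^ 0\<close>,
  and \<open>v n\<close> tends to \<open>0\<close> since its order is at least
  \<open>n\<^sup>2\<close>.\<close>

lemma rr_sum_rec:
  "rr_sum i = (1 + fps_X ^ (2 * i + 1) + fps_X ^ (2 * i + 2)) * rr_sum (i + 1) -
     fps_X ^ (4 * i + 5) * rr_sum (i + 2)"
proof -
  define v where "v = (\<lambda>n. (1 - fps_X ^ (2 * n)) * fps_X ^ (2 * i * n + n\<^sup>2) *
    inverse (qpoch (fps_X\<^sup>2) (fps_X\<^sup>2) n * qpoch (- (fps_X\<^sup>2)) (fps_X\<^sup>2) (n + i + 1)) :: rat fps)"
  define L where "L = rr_sum i - ((1 + fps_X ^ (2 * i + 1) + fps_X ^ (2 * i + 2)) * rr_sum (i + 1) -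
     fps_X ^ (4 * i + 5) * rr_sum (i + 2))"
  have T: "(\<lambda>n. sum (rr_term j) {..<n}) \<longlonglongrightarrow> rr_sum j" for j
    using rr_term_sums[of j] by (simp add: sums_def)
  have "(\<lambda>n. sum (rr_term i) {..<n} -
      ((1 + fps_X ^ (2 * i + 1) + fps_X ^ (2 * i + 2)) * sum (rr_term (i + 1)) {..<n} -
       fps_X ^ (4 * i + 5) * sum (rr_term (i + 2)) {..<n})) \<longlonglongrightarrow> L"
    unfolding L_def by (intro tendsto_diff_fps tendsto_mult_fps tendsto_const T)
  also have "(\<lambda>n. sum (rr_term i) {..<n} -
      ((1 + fps_X ^ (2 * i + 1) + fps_X ^ (2 * i + 2)) * sum (rr_term (i + 1)) {..<n} -
       fps_X ^ (4 * i + 5) * sum (rr_term (i + 2)) {..<n})) = (\<lambda>n. - v n)"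
  proof
    fix n
    have "(\<Sum>k<n. rr_term i k - (1 + fps_X ^ (2 * i + 1) + fps_X ^ (2 * i + 2)) * rr_term (i + 1) k +
        fps_X ^ (4 * i + 5) * rr_term (i + 2) k) = (\<Sum>k<n. v k - v (Suc k))"
      unfolding rr_term_telescope v_def ..
    also have "\<dots> = - v n"
      unfolding sum_lessThan_telescope' by (simp add: v_def)
    finally show "sum (rr_term i) {..<n} -
      ((1 + fps_X ^ (2 * i + 1) + fps_X ^ (2 * i + 2)) * sum (rr_term (i + 1)) {..<n} -
       fps_X ^ (4 * i + 5) * sum (rr_term (i + 2)) {..<n}) = - v n"
      by (simp add: sum.distrib sum_subtractf diff_diff_eq2 diff_add_eq flip: sum_distrib_left)
  qed
  finally have 1: "(\<lambda>n. - v n) \<longlonglongrightarrow> L" .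
  have "(\<lambda>n. - v n) \<longlonglongrightarrow> 0"
  proof (rule tendsto_fpsI)
    fix k
    have "fps_nth (- v n) k = fps_nth 0 k" if "n > k" for n
    proof -
      have "n \<le> n\<^sup>2"
        by (simp add: power2_eq_square)
      then have "k < 2 * i * n + n\<^sup>2"
        using that by linarith
      then show ?thesis
        by (simp add: v_def mult.assoc mult.left_commute[of "1 - _" "fps_X ^ _"] fps_X_power_mult_nth)
    qed
    then show "\<forall>\<^sub>F n in sequentially. fps_nth (- v n) k = fps_nth 0 k"
      unfolding eventually_sequentially by (metis Suc_le_eq)
  qed
  with 1 have "L = 0"
    by (rule LIMSEQ_unique)
  then show ?thesis
    by (simp add: L_def)
qed

text \<open>By induction on the degree \<open>n\<close>, all lower coefficients vanish for every
  index. The recurrence then makes coefficient \<open>n\<close> independent of \<open>i\<close>, so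
  it equals its limit \<open>0\<close>.\<close>

lemma rr_recurrence_unique:
  fixes d :: "nat \<Rightarrow> 'a::comm_ring_1 fps"
  assumes rec: "\<And>i. d i = (1 + fps_X ^ (2 * i + 1) + fps_X ^ (2 * i + 2)) * d (i + 1) -
     fps_X ^ (4 * i + 5) * d (i + 2)"
    and lim: "d \<longlonglongrightarrow> 0"
  shows "d i = 0"
proof (rule fps_ext)
  fix n
  show "fps_nth (d i) n = fps_nth 0 n"
  proof (induction n arbitrary: i rule: less_induct)
    case (less n)
    have step: "fps_nth (d j) n = fps_nth (d (Suc j)) n" for j
      by (subst rec) (use less in \<open>simp add: distrib_right fps_X_power_mult_nth del: power_Suc\<close>)
    have const: "fps_nth (d (i + k)) n = fps_nth (d i) n" for k
      by (induction k) (simp_all add: step[symmetric])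
    obtain N where "\<And>j. j \<ge> N \<Longrightarrow> fps_nth (d j) n = 0"
      using lim by (auto simp: tendsto_fps_iff eventually_sequentially)
    then show ?case
      using const[of N] by simp
  qed
qed

text \<open>The new factor \<open>1 + fps_X ^ (2 * n + 2)\<close> leaves the coefficients up to
  \<open>n\<close> unchanged, so the limit behind \<open>qpoch_inf\<close> exists.\<close>

lemma qpoch_LIMSEQ_inf:
  "qpoch (- (fps_X\<^sup>2)) (fps_X\<^sup>2) \<longlonglongrightarrow> (qpoch_inf (- (fps_X\<^sup>2)) (fps_X\<^sup>2) :: rat fps)"
proof -
  have "fps_nth (qpoch (- (fps_X\<^sup>2)) (fps_X\<^sup>2) (Suc n)) k =
      fps_nth (qpoch (- (fps_X\<^sup>2)) (fps_X\<^sup>2) n :: rat fps) k" if "k \<le> n" for n k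
  proof -
    have "(fps_X\<^sup>2 * (fps_X\<^sup>2) ^ n :: rat fps) = fps_X ^ (2 * n + 2)"
      by (simp add: add.commute flip: power_mult power_add)
    then show ?thesis
      using that by (simp add: qpoch_Suc distrib_left fps_X_power_mult_right_nth del: power_Suc add_2_eq_Suc')
  qed
  from convergent_fps[where S = "qpoch (- (fps_X\<^sup>2)) (fps_X\<^sup>2) :: nat \<Rightarrow> rat fps", OF this] show ?thesis
    unfolding qpoch_inf_def by (metis limI)
qed

text \<open>For large \<open>i\<close> only the summand \<open>n = 0\<close> reaches a given
  coefficient, and it is the inverse of the \<open>i\<close>-th partial product of
  \<open>qpoch_inf\<close>.\<close>

lemma rr_sum_LIMSEQ: "(\<lambda>i. qpoch_inf (- (fps_X\<^sup>2)) (fps_X\<^sup>2) * rr_sum i) \<longlonglongrightarrow> 1"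
proof -
  define P :: "rat fps" where "P = qpoch_inf (- (fps_X\<^sup>2)) (fps_X\<^sup>2)"
  have P0: "fps_nth P 0 = 1"
  proof -
    have "\<forall>\<^sub>F n in sequentially. fps_nth (qpoch (- (fps_X\<^sup>2)) (fps_X\<^sup>2) n) 0 = fps_nth P 0"
      using qpoch_LIMSEQ_inf unfolding P_def tendsto_fps_iff by blast
    then show ?thesis
      by (simp add: qpoch_fps_nth_0)
  qed
  have "rr_sum \<longlonglongrightarrow> inverse P"
  proof (rule tendsto_fpsI)
    fix k
    have "(\<lambda>i. inverse (qpoch (- (fps_X\<^sup>2)) (fps_X\<^sup>2) i)) \<longlonglongrightarrow> inverse P"
      using qpoch_LIMSEQ_inf P0 unfolding P_def by (intro tendsto_inverse_fps) auto
    then have "\<forall>\<^sub>F i in sequentially.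
        fps_nth (inverse (qpoch (- (fps_X\<^sup>2)) (fps_X\<^sup>2) i)) k = fps_nth (inverse P) k"
      by (simp add: tendsto_fps_iff)
    then show "\<forall>\<^sub>F i in sequentially. fps_nth (rr_sum i) k = fps_nth (inverse P) k"
      using eventually_gt_at_top[of k]
    proof eventually_elim
      case (elim i)
      have "fps_nth (rr_term i n) k = 0" if "n > 0" for n
      proof -
        have "i \<le> i * n" using that by simp
        then have "k < 2 * i * n + n\<^sup>2" using elim by linarith
        then show ?thesis
          by (simp add: rr_term_def fps_X_power_mult_nth)
      qed
      then have partial: "fps_nth (sum (rr_term i) {..<Suc n}) k = fps_nth (rr_term i 0) k" for n
        by (induction n) simp_all
      obtain N where "\<And>n. n \<ge> N \<Longrightarrow> fps_nth (sum (rr_term i) {..<n}) k = fps_nth (rr_sum i) k"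
        using rr_term_sums[of i] by (auto simp: sums_def tendsto_fps_iff eventually_sequentially)
      from this[of "Suc N"] have "fps_nth (rr_sum i) k = fps_nth (rr_term i 0) k"
        using partial[of N] by simp
      with elim show ?case
        by (simp add: rr_term_def)
    qed
  qed
  then have "(\<lambda>i. P * rr_sum i) \<longlonglongrightarrow> P * inverse P"
    by (intro tendsto_mult_fps tendsto_const)
  also have "P * inverse P = 1"
    using P0 by (intro inverse_mult_eq_1') auto
  finally show ?thesis
    unfolding P_def .
qed

lemma gen_fun_sparse_sets_LIMSEQ:
  "(\<lambda>j. gen_fun (sparse_sets j) (sum Suc)) \<longlonglongrightarrow> (1 :: 'a::ring_1 fps)"
proof (rule gen_fun_LIMSEQ_1)
  show "{} \<in> sparse_sets j" for j
    by (simp add: sparse_sets_def)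
  fix j and Y :: "nat set"
  assume Y: "Y \<in> sparse_sets j" "Y \<noteq> {}"
  then obtain y where "y \<in> Y" "finite Y" "j \<le> y"
    by (auto simp: sparse_sets_def)
  then show "j < sum Suc Y"
    using le_sum_Suc[of Y y] by simp
qed simp

lemma gen_fun_sparse_sets_eq_rr_sum:
  "gen_fun (sparse_sets (2 * i)) (sum Suc) =
     qpoch_inf (- (fps_X\<^sup>2)) (fps_X\<^sup>2) * rr_sum i"
proof -
  define E :: "nat \<Rightarrow> rat fps" where "E = (\<lambda>j. gen_fun (sparse_sets j) (sum Suc))"
  define P :: "rat fps" where "P = qpoch_inf (- (fps_X\<^sup>2)) (fps_X\<^sup>2)"
  have E_rec: "E j = E (j + 1) + fps_X ^ (j + 1) * E (j + 2)" for j
    unfolding E_def by (rule gen_fun_sparse_sets_rec)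
  define a b c :: "nat \<Rightarrow> rat fps"
    where "a = (\<lambda>i. fps_X ^ (2 * i + 1))" and "b = (\<lambda>i. fps_X ^ (2 * i + 2))"
      and "c = (\<lambda>i. fps_X ^ (2 * i + 3))"
  have bc: "b i * c i = fps_X ^ (4 * i + 5)" for i
    by (simp only: b_def c_def flip: power_add) simp
  have E: "E (2 * i) = (1 + a i + b i) * E (2 * (i + 1)) - fps_X ^ (4 * i + 5) * E (2 * (i + 2))" for i
  proof -
    have e0: "E (2 * i) = E (2 * i + 1) + a i * E (2 * i + 2)"
      using E_rec[of "2 * i"] by (simp only: a_def)
    have e1: "E (2 * i + 1) = E (2 * i + 2) + b i * E (2 * i + 3)"
      using E_rec[of "2 * i + 1"] by (simp only: b_def add.assoc one_add_one) (simp add: numeral_3_eq_3)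
    \<comment> \<open>The recurrence at \<open>2 * i + 2\<close>, solved for its odd-indexed term,
      eliminates \<open>E (2 * i + 3)\<close>.\<close>
    have e2: "E (2 * i + 3) = E (2 * i + 2) - c i * E (2 * i + 4)"
      using E_rec[of "2 * i + 2"] by (simp add: c_def numeral_eq_Suc)
    have "E (2 * i) = (1 + a i + b i) * E (2 * i + 2) - b i * c i * E (2 * i + 4)"
      unfolding e0 e1 e2 by (simp add: algebra_simps)
    then show ?thesis
      by (simp add: bc numeral_eq_Suc)
  qed
  have "E (2 * i) - P * rr_sum i = 0"
  proof (rule rr_recurrence_unique)
    fix i
    show "E (2 * i) - P * rr_sum i = (1 + fps_X ^ (2 * i + 1) + fps_X ^ (2 * i + 2)) *
        (E (2 * (i + 1)) - P * rr_sum (i + 1)) -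
        fps_X ^ (4 * i + 5) * (E (2 * (i + 2)) - P * rr_sum (i + 2))"
      unfolding E[of i] rr_sum_rec[of i] a_def b_def by (simp only: algebra_simps)
  next
    have "(\<lambda>i. E (2 * i)) \<longlonglongrightarrow> 1"
      using LIMSEQ_subseq_LIMSEQ[OF gen_fun_sparse_sets_LIMSEQ, of "(*) 2"]
      by (simp add: E_def o_def strict_mono_def)
    from tendsto_diff_fps[OF this rr_sum_LIMSEQ]
    show "(\<lambda>i. E (2 * i) - P * rr_sum i) \<longlonglongrightarrow> 0"
      by (simp add: P_def)
  qed
  then show ?thesis
    by (simp add: E_def P_def)
qed

section \<open>The generating function for profile (1,1,0)\<close>

theorem theorem4p4:
  fixes q :: "rat fps"
  defines "q \<equiv> fps_X"
  shows "(\<Sum>\<^sub>\<infinity>L\<in>cylindric_partitions [1, 1, 0]. q ^ cylindric_size L) =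
           (\<Sum>n. q ^ (n ^ 2) / qpoch (q ^ 4) (q ^ 4) n) *
           (qpoch_inf (- (q ^ 2)) (q ^ 2) / qpoch_inf q q)"
proof -
  define p :: "rat fps" where "p = gen_fun (Collect is_partition) partition_size"
  define P :: "rat fps" where "P = qpoch_inf (- (q\<^sup>2)) (q\<^sup>2)"
  have "{h\<in>Collect is_partition. partition_size h = 0} = {\<lambda>_. 0}"
    using is_partition_zero by (auto simp: partition_size_def is_partition_def)
  then have p0: "fps_nth p 0 = 1"
    by (simp add: p_def gen_fun_nth)
  \<comment> \<open>As \<open>p\<close> has constant term \<open>1\<close>, its inverse is a unit,
    and dividing by \<open>qpoch_inf q q\<close> means multiplying by \<open>p\<close>.\<close>
  have inf: "P / qpoch_inf q q = P * p"
    unfolding q_def qpoch_inf_eq_inverse_partitions p_def[symmetric]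
    using p0 by (subst fps_divide_unit) simp_all
  have summand: "q ^ (n ^ 2) / qpoch (q ^ 4) (q ^ 4) n = rr_term 0 n" for n
  proof -
    have "q ^ 4 = (q\<^sup>2)\<^sup>2"
      by simp
    then have "qpoch (q ^ 4) (q ^ 4) n = qpoch (q\<^sup>2) (q\<^sup>2) n * qpoch (- (q\<^sup>2)) (q\<^sup>2) n"
      by (simp only: qpoch_square)
    moreover have "fps_nth (qpoch (q ^ 4) (q ^ 4) n) 0 \<noteq> 0"
      by (subst qpoch_fps_nth_0) (simp_all add: q_def)
    ultimately show ?thesis
      by (simp add: fps_divide_unit rr_term_def q_def)
  qed
  have "(\<Sum>\<^sub>\<infinity>L\<in>cylindric_partitions [1, 1, 0]. q ^ cylindric_size L) =
      gen_fun (sparse_sets 0) (sum Suc) * p"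
    unfolding q_def p_def by (rule infsumI[OF has_sum_cylindric_partitions_110])
  also have "\<dots> = rr_sum 0 * (P * p)"
    using gen_fun_sparse_sets_eq_rr_sum[of 0] by (simp add: P_def q_def mult_ac)
  finally show ?thesis
    unfolding summand P_def[symmetric] inf by (simp add: rr_sum_def)
qed

end
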